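(* Let $k \geq 2$ be an integer. Then for all sufficiently large $d$, \[ M_{k}(d) \geq \frac{3}{2 \pi^2} \Big( \frac{k}{k-1} \Big)^2 (\log{d})^2 + O ( \log d \log \log d), \] i.e. there are constants $C>0$ and $d_0$ (depending on $k$) such that $M_k(d) \ge \frac{3}{2 \pi^2} \big( \frac{k}{k-1} \big)^2 (\log{d})^2 - C\log d\log\log d$ for all $d \ge d_0$.
   Context: $p(n)$ denotes the number of partitions of the positive integer $n$. For integers $k \ge 2$ and $n \ge 1$, let $\Delta_k(n) := \min\{|p(n) - m^k| : m \in \mathbb{Z}\}$ be the distance from $p(n)$ to the nearest $k$th power. For an integer $d \ge 0$, let $M_k(d) := \max\{n \in \mathbb{N} : \Delta_k(n) \le d\}$, where $M_k(d) = \infty$ if this maximum does not exist. *)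

theory Defs
  imports "HOL-Analysis.Analysis" "HOL-Library.Multiset"
begin

definition partitions :: "nat \<Rightarrow> nat multiset set" where
  "partitions n = {P. 0 \<notin># P \<and> sum_mset P = n}"

definition partition_number :: "nat \<Rightarrow> nat" where
  "partition_number n = card (partitions n)"

definition power_dist :: "nat \<Rightarrow> nat \<Rightarrow> nat" where
  "power_dist k n = (LEAST \<delta>. \<exists>m::int. \<delta> = nat \<bar>int (partition_number n) - m ^ k\<bar>)"

text \<open>The set below always contains \<open>1\<close>, since \<open>p(1) = 1\<close> is a \<open>k\<close>th power; hence its maximum
  fails to exist only when it is infinite.\<close>

definition max_power_index :: "nat \<Rightarrow> nat \<Rightarrow> enat" where
  "max_power_index k d =
    (let S = {n. n \<ge> 1 \<and> power_dist k n \<le> d} in if finite S then enat (Max S) else \<infinity>)"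

lemma finite_partitions: "finite (partitions n)"
proof (rule finite_subset)
  show "partitions n \<subseteq> mset ` {xs. set xs \<subseteq> {..n} \<and> length xs \<le> n}"
  proof
    fix P assume "P \<in> partitions n"
    then have P: "0 \<notin># P" "sum_mset P = n" by (auto simp: partitions_def)
    obtain xs where xs: "P = mset xs" by (metis ex_mset)
    have "length xs \<le> sum_list xs" if "0 \<notin> set xs" for xs :: "nat list"
      using that by (induction xs) auto
    with P xs have "length xs \<le> n" by (auto simp: sum_mset_sum_list)
    moreover have "set xs \<subseteq> {..n}"
      using P xs by (auto simp: sum_mset_sum_list member_le_sum_list)
    ultimately show "P \<in> mset ` {xs. set xs \<subseteq> {..n} \<and> length xs \<le> n}"
      using xs by blast
  qed
  show "finite (mset ` {xs. set xs \<subseteq> {..n} \<and> length xs \<le> n})"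
    by (intro finite_imageI finite_lists_length_le) simp
qed

lemma partitions_one: "partitions 1 = {{#1#}}"
proof
  show "partitions 1 \<subseteq> {{#1#}}"
  proof
    fix P assume "P \<in> partitions 1"
    then have P: "0 \<notin># P" "sum_mset P = 1" by (auto simp: partitions_def)
    then obtain a Q where PQ: "P = add_mset a Q" by (cases P) auto
    with P have "a \<noteq> 0" "a + sum_mset Q = 1" by auto
    then have a: "a = 1" "sum_mset Q = 0" by linarith+
    with P PQ have "Q = {#}" by (cases Q) auto
    with a PQ show "P \<in> {{#1#}}" by simp
  qed
qed (auto simp: partitions_def)

lemma power_dist_attained:
  "\<exists>m::int. int (power_dist k n) = \<bar>int (partition_number n) - m ^ k\<bar>"
proof -
  have "\<exists>m::int. power_dist k n = nat \<bar>int (partition_number n) - m ^ k\<bar>"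
    unfolding power_dist_def by (rule LeastI_ex) blast
  then show ?thesis by fastforce
qed

lemma power_dist_le: "int (power_dist k n) \<le> \<bar>int (partition_number n) - m ^ k\<bar>"
proof -
  have "power_dist k n \<le> nat \<bar>int (partition_number n) - m ^ k\<bar>"
    unfolding power_dist_def by (rule Least_le) blast
  then show ?thesis by linarith
qed

lemma power_dist_one: "power_dist k 1 = 0"
  using power_dist_le[of k 1 1] by (simp add: partition_number_def partitions_one[simplified])

end

theory Submission
  imports Defs
begin

text \<open>An integer \<open>p \<ge> 1\<close> lies within \<open>O(p\<^bsup>(k-1)/k\<^esup>)\<close> of a \<open>k\<close>th power, so it suffices to bound
  \<open>p(n)\<close> from above by \<open>exp (c \<surd>n)\<close> with \<open>c = \<pi> \<surd>(2/3)\<close>. Following Erdos, this is an induction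
  on \<open>n\<close> using \<open>n p(n) = \<Sum>\<^bsub>m j \<le> n\<^esub> m p(n - m j)\<close>, which comes from summing the parts of all
  partitions of \<open>n\<close>. The constant \<open>c\<close> is the one for which
  \<open>4 / c\<^sup>2 \<cdot> (1 + 1/4 + 1/9 + \<dots>) = 1\<close>.\<close>

section \<open>Double counting of the parts of all partitions of \<open>n\<close>\<close>

lemma card_partitions_count_ge:
  "card {P \<in> partitions n. j \<le> count P m} \<le> (if m * j \<le> n then partition_number (n - m * j) else 0)"
proof (cases "m * j \<le> n")
  case True
  let ?A = "{P \<in> partitions n. j \<le> count P m}"
  have sub: "replicate_mset j m \<subseteq># P" if "P \<in> ?A" for P
    using that by (simp add: count_le_replicate_mset_subset_eq)
  \<comment> \<open>Deleting \<open>j\<close> copies of \<open>m\<close> leaves a partition of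
    \<open>n - m * j\<close>, and putting them back recovers \<open>P\<close>.\<close>
  have "inj_on (\<lambda>P. P - replicate_mset j m) ?A"
  proof (rule inj_onI)
    fix P Q assume "P \<in> ?A" "Q \<in> ?A" "P - replicate_mset j m = Q - replicate_mset j m"
    then show "P = Q" using sub by (metis subset_mset.diff_add)
  qed
  moreover have "(\<lambda>P. P - replicate_mset j m) ` ?A \<subseteq> partitions (n - m * j)"
    using sub by (auto simp: partitions_def sum_mset_diff mult.commute dest: in_diffD)
  ultimately have "card ?A \<le> card (partitions (n - m * j))"
    by (rule card_inj_on_le) (rule finite_partitions)
  then show ?thesis using True by (simp add: partition_number_def)
next
  case False
  have "{P \<in> partitions n. j \<le> count P m} = {}"
  proof (rule equals0I)
    fix P assume "P \<in> {P \<in> partitions n. j \<le> count P m}"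
    then have P: "sum_mset P = n" "replicate_mset j m \<subseteq># P"
      by (auto simp: partitions_def count_le_replicate_mset_subset_eq)
    then have "sum_mset (replicate_mset j m) \<le> sum_mset P"
      by (metis le_add1 subset_mset.add_diff_inverse sum_mset.union)
    with P False show False by (simp add: mult.commute)
  qed
  then show ?thesis by (simp only: card.empty)
qed

lemma sum_mset_eq_sum_count:
  fixes P :: "nat multiset"
  assumes "finite A" "set_mset P \<subseteq> A"
  shows "sum_mset P = (\<Sum>m\<in>A. count P m * m)"
  using assms(2)
proof (induction P)
  case (add x P)
  have "(\<Sum>m\<in>A. count (add_mset x P) m * m) = (\<Sum>m\<in>A. (if m = x then x else 0) + count P m * m)"
    by (rule sum.cong) auto
  also have "\<dots> = x + (\<Sum>m\<in>A. count P m * m)"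
    using assms(1) add.prems by (simp add: sum.distrib)
  finally show ?case using add by simp
qed simp

text \<open>The contribution \<open>count P m * m\<close> of the part size \<open>m\<close> is
  \<open>m\<close> taken once for each \<open>j\<close> from 1 to \<open>count P m\<close>. The
  index ranges do not depend on \<open>P\<close>, so that the double sum can be interchanged with a
  sum over all partitions.\<close>

lemma partition_sum_counts:
  assumes "P \<in> partitions n"
  shows "n = (\<Sum>m\<in>{1..n}. \<Sum>j\<in>{1..n}. if j \<le> count P m then m else 0)"
proof -
  have P: "0 \<notin># P" "sum_mset P = n" using assms by (auto simp: partitions_def)
  have le: "count P m * m \<le> n" for m
  proof -
    have "replicate_mset (count P m) m \<subseteq># P"
      by (simp add: count_le_replicate_mset_subset_eq[symmetric])
    then have "sum_mset (replicate_mset (count P m) m) \<le> sum_mset P"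
      by (metis le_add1 subset_mset.add_diff_inverse sum_mset.union)
    then show ?thesis using P by simp
  qed
  have sub: "set_mset P \<subseteq> {1..n}"
  proof
    fix m assume m: "m \<in># P"
    then have "1 \<le> m" using P by (cases m) auto
    moreover have "1 * m \<le> count P m * m"
      using m by (intro mult_right_mono) (auto simp: Suc_le_eq)
    ultimately show "m \<in> {1..n}" using le[of m] unfolding atLeastAtMost_iff by linarith
  qed
  have "n = (\<Sum>m\<in>{1..n}. count P m * m)"
    using P sum_mset_eq_sum_count[OF _ sub] by simp
  also have "\<dots> = (\<Sum>m\<in>{1..n}. \<Sum>j\<in>{1..n}. if j \<le> count P m then m else 0)"
  proof (rule sum.cong[OF refl])
    fix m assume "m \<in> {1..n}"
    \<comment> \<open>As \<open>m\<close> is at least 1, no multiplicity exceeds \<open>n\<close>,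
      so the cutoff of \<open>j\<close> at \<open>n\<close> loses nothing.\<close>
    then have "count P m \<le> count P m * m" by simp
    then have "count P m \<le> n" using le[of m] by linarith
    then have "{1..n} \<inter> {j. j \<le> count P m} = {1..count P m}" by auto
    then show "count P m * m = (\<Sum>j\<in>{1..n}. if j \<le> count P m then m else 0)"
      by (simp add: sum.If_cases)
  qed
  finally show ?thesis .
qed

lemma partition_number_recurrence_le:
  "n * partition_number n
    \<le> (\<Sum>m\<in>{1..n}. \<Sum>j\<in>{1..n}. if m * j \<le> n then m * partition_number (n - m * j) else 0)"
proof -
  have "n * partition_number n = (\<Sum>P\<in>partitions n. n)"
    by (simp add: partition_number_def)
  also have "\<dots> = (\<Sum>P\<in>partitions n. \<Sum>m\<in>{1..n}. \<Sum>j\<in>{1..n}. if j \<le> count P m then m else 0)"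
    by (rule sum.cong[OF refl]) (rule partition_sum_counts)
  also have "\<dots> = (\<Sum>m\<in>{1..n}. \<Sum>P\<in>partitions n. \<Sum>j\<in>{1..n}. if j \<le> count P m then m else 0)"
    by (rule sum.swap)
  also have "\<dots> = (\<Sum>m\<in>{1..n}. \<Sum>j\<in>{1..n}. \<Sum>P\<in>partitions n. if j \<le> count P m then m else 0)"
    by (rule sum.cong[OF refl]) (rule sum.swap)
  \<comment> \<open>With the sum over \<open>P\<close> innermost, each pair \<open>m\<close>,
    \<open>j\<close> counts the partitions having at least \<open>j\<close> parts equal to
    \<open>m\<close>.\<close>
  also have "\<dots> = (\<Sum>m\<in>{1..n}. \<Sum>j\<in>{1..n}. m * card {P \<in> partitions n. j \<le> count P m})"
    by (simp add: sum.If_cases finite_partitions Int_def mult.commute)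
  also have "\<dots> \<le> (\<Sum>m\<in>{1..n}. \<Sum>j\<in>{1..n}.
      m * (if m * j \<le> n then partition_number (n - m * j) else 0))"
    by (intro sum_mono mult_left_mono card_partitions_count_ge) simp
  also have "\<dots> = (\<Sum>m\<in>{1..n}. \<Sum>j\<in>{1..n}. if m * j \<le> n then m * partition_number (n - m * j) else 0)"
    by (intro sum.cong) auto
  finally show ?thesis .
qed

section \<open>Estimates for series and for the square root\<close>

text \<open>After a factor \<open>x\<close> is taken out, this is a partial sum of the
  differentiated geometric series, whose terms are nonnegative.\<close>

lemma sum_nat_mult_power_le:
  fixes x :: real
  assumes "0 \<le> x" "x < 1"
  shows "(\<Sum>m\<in>{1..n}. real m * x ^ m) \<le> x / (1 - x)\<^sup>2"
proof -
  have s: "(\<lambda>i. real (Suc i) * x ^ i) sums (1 / (1 - x)\<^sup>2)"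
    using geometric_deriv_sums[of x] assms by simp
  have "(\<Sum>m\<in>{1..n}. real m * x ^ m) = x * (\<Sum>i<n. real (Suc i) * x ^ i)"
    by (simp add: sum.atLeast1_atMost_eq sum_distrib_left mult_ac del: of_nat_Suc)
  also have "(\<Sum>i<n. real (Suc i) * x ^ i) \<le> 1 / (1 - x)\<^sup>2"
    using sum_le_suminf[OF sums_summable[OF s], of "{..<n}"] sums_unique[OF s] assms by simp
  finally show ?thesis using assms by (simp add: mult_left_mono)
qed

text \<open>The left side is \<open>1 / (2 * sinh (y / 2))\<^sup>2\<close>, and sinh t \<ge> t for t
  \<ge> 0.\<close>

lemma exp_div_square_le:
  fixes y :: real
  assumes "0 < y"
  shows "exp (- y) / (1 - exp (- y))\<^sup>2 \<le> 1 / y\<^sup>2"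
proof -
  let ?u = "exp (y / 2)"
  have "y \<le> ?u - inverse ?u" using real_le_x_sinh[of "y / 2"] assms by simp
  then have "y\<^sup>2 \<le> (?u - inverse ?u)\<^sup>2" using assms by (intro power_mono) auto
  then have "1 / (?u - inverse ?u)\<^sup>2 \<le> 1 / y\<^sup>2"
    using assms by (intro frac_le) auto
  moreover have "exp (- y) = (inverse ?u)\<^sup>2"
    by (simp add: power2_eq_square exp_minus[symmetric] exp_add[symmetric])
  moreover have "(inverse ?u)\<^sup>2 / (1 - (inverse ?u)\<^sup>2)\<^sup>2 = 1 / (?u - inverse ?u)\<^sup>2"
  proof -
    have "1 - (inverse ?u)\<^sup>2 = inverse ?u * (?u - inverse ?u)"
      by (simp add: power2_eq_square right_diff_distrib)
    then show ?thesis by (simp only: power_mult_distrib) simp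
  qed
  ultimately show ?thesis by simp
qed

lemma sum_inverse_squares_le: "(\<Sum>j\<in>{1..n}. 1 / (real j)\<^sup>2) \<le> pi\<^sup>2 / 6"
proof -
  have s: "(\<lambda>i. 1 / (real i + 1)\<^sup>2) sums (pi\<^sup>2 / 6)"
    using inverse_squares_sums by (simp add: add_ac)
  have "(\<Sum>j\<in>{1..n}. 1 / (real j)\<^sup>2) = (\<Sum>i<n. 1 / (real i + 1)\<^sup>2)"
    by (simp add: sum.atLeast1_atMost_eq add_ac)
  also have "\<dots> \<le> pi\<^sup>2 / 6"
    using sum_le_suminf[OF sums_summable[OF s], of "{..<n}"] sums_unique[OF s] by simp
  finally show ?thesis .
qed

text \<open>The concave square root lies below its tangent at \<open>a\<close>. Being linear in
  \<open>b\<close>, the bound makes the terms of the recurrence geometric in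
  \<open>m\<close>.\<close>

lemma sqrt_diff_le:
  assumes "0 < a" "b \<le> a"
  shows "sqrt (a - b) \<le> sqrt a - b / (2 * sqrt a)"
proof -
  have "0 \<le> (sqrt a - sqrt (a - b))\<^sup>2" by simp
  also have "\<dots> = 2 * a - b - 2 * sqrt a * sqrt (a - b)"
    using assms by (simp add: power2_diff)
  finally have "2 * sqrt a * sqrt (a - b) \<le> 2 * sqrt a * sqrt a - b"
    using assms by (simp add: mult.assoc)
  then show ?thesis using assms by (simp add: field_simps del: real_sqrt_mult_self)
qed

section \<open>The exponential upper bound for p(n)\<close>

lemma partition_number_zero: "partition_number 0 = 1"
proof -
  have "partitions 0 = {{#}}"
    by (auto simp: partitions_def) (metis multiset_nonemptyE)
  then show ?thesis by (simp add: partition_number_def)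
qed

lemma partition_number_upper_bound:
  "real (partition_number n) \<le> exp (pi * sqrt (2 / 3) * sqrt (real n))"
proof (induction n rule: less_induct)
  case (less n)
  show ?case
  proof (cases "n = 0")
    case True
    then show ?thesis by (simp add: partition_number_zero)
  next
    case False
    define c where "c = pi * sqrt (2 / 3)"
    define s where "s = sqrt (real n)"
    \<comment> \<open>The slope of \<open>c * sqrt t\<close> at \<open>t = n\<close>: lowering the
      argument by \<open>m * j\<close> costs at least a factor
      \<open>exp (- (y * m * j))\<close>.\<close>
    define y where "y = c / (2 * s)"
    have c: "c > 0" "c\<^sup>2 = pi\<^sup>2 * (2 / 3)" by (auto simp: c_def power_mult_distrib)
    have s: "s > 0" "s\<^sup>2 = real n" using False by (auto simp: s_def)
    have y: "y > 0" using c s by (simp add: y_def)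
    have summand: "(if m * j \<le> n then real m * real (partition_number (n - m * j)) else 0)
        \<le> exp (c * s) * (real m * exp (- (y * real j)) ^ m)" if "m \<in> {1..n}" "j \<in> {1..n}" for m j
    proof (cases "m * j \<le> n")
      case True
      have pos: "n - m * j < n" using that by auto
      have "real (m * j) \<le> real n" using True by (simp only: of_nat_le_iff)
      then have "sqrt (real n - real (m * j)) \<le> s - real (m * j) / (2 * s)"
        unfolding s_def using False by (intro sqrt_diff_le) auto
      then have "c * sqrt (real (n - m * j)) \<le> c * (s - real (m * j) / (2 * s))"
        using c True by (intro mult_left_mono) (auto simp: of_nat_diff simp del: of_nat_mult)
      also have "\<dots> = c * s + real m * (- (y * real j))"
        by (simp add: y_def field_simps)
      finally have "exp (c * sqrt (real (n - m * j))) \<le> exp (c * s) * exp (- (y * real j)) ^ m"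
        by (simp add: exp_add[symmetric] exp_of_nat_mult[symmetric])
      moreover have "real (partition_number (n - m * j)) \<le> exp (c * sqrt (real (n - m * j)))"
        using less.IH[OF pos] by (simp add: c_def)
      ultimately have "real (partition_number (n - m * j)) \<le> exp (c * s) * exp (- (y * real j)) ^ m"
        by linarith
      then show ?thesis using True that
        by (simp add: mult.left_commute[of "exp (c * s)"] mult_left_mono)
    qed auto
    have "real n * real (partition_number n) \<le>
        (\<Sum>m\<in>{1..n}. \<Sum>j\<in>{1..n}. if m * j \<le> n then real m * real (partition_number (n - m * j)) else 0)"
    proof -
      have "real (n * partition_number n) \<le> real (\<Sum>m\<in>{1..n}. \<Sum>j\<in>{1..n}.
          if m * j \<le> n then m * partition_number (n - m * j) else 0)"
        by (simp only: of_nat_le_iff partition_number_recurrence_le)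
      then show ?thesis by (simp add: if_distrib[of real] cong: if_cong)
    qed
    also have "\<dots> \<le> (\<Sum>m\<in>{1..n}. \<Sum>j\<in>{1..n}. exp (c * s) * (real m * exp (- (y * real j)) ^ m))"
      by (intro sum_mono summand)
    \<comment> \<open>The sum over \<open>m\<close> is moved inside, since for fixed
      \<open>j\<close> it has the form of \<open>sum_nat_mult_power_le\<close> with ratio
      \<open>exp (- (y * j))\<close>.\<close>
    also have "\<dots> = (\<Sum>j\<in>{1..n}. exp (c * s) * (\<Sum>m\<in>{1..n}. real m * exp (- (y * real j)) ^ m))"
      unfolding sum_distrib_left by (rule sum.swap)
    also have "\<dots> \<le> (\<Sum>j\<in>{1..n}. exp (c * s) * (1 / y\<^sup>2 * (1 / (real j)\<^sup>2)))"
    proof (intro sum_mono mult_left_mono)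
      fix j assume j: "j \<in> {1..n}"
      then have yj: "y * real j > 0" using y by simp
      have "(\<Sum>m\<in>{1..n}. real m * exp (- (y * real j)) ^ m)
          \<le> exp (- (y * real j)) / (1 - exp (- (y * real j)))\<^sup>2"
        using yj by (intro sum_nat_mult_power_le) auto
      also have "\<dots> \<le> 1 / (y * real j)\<^sup>2" by (rule exp_div_square_le[OF yj])
      finally show "(\<Sum>m\<in>{1..n}. real m * exp (- (y * real j)) ^ m) \<le> 1 / y\<^sup>2 * (1 / (real j)\<^sup>2)"
        by (simp add: power_mult_distrib)
    qed simp
    also have "\<dots> = exp (c * s) * (1 / y\<^sup>2) * (\<Sum>j\<in>{1..n}. 1 / (real j)\<^sup>2)"
      by (simp add: sum_distrib_left)
    also have "\<dots> \<le> exp (c * s) * (1 / y\<^sup>2) * (pi\<^sup>2 / 6)"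
      by (intro mult_left_mono sum_inverse_squares_le) simp
    \<comment> \<open>Here \<open>1 / y\<^sup>2 = 4 * n / c\<^sup>2 = 6 * n / pi\<^sup>2\<close>,
      which cancels \<open>pi\<^sup>2 / 6\<close> and leaves exactly the factor \<open>n\<close> of
      the left side.\<close>
    also have "\<dots> = real n * exp (c * s)"
      unfolding y_def power_divide power_mult_distrib c s by simp
    finally show ?thesis using False by (simp add: c_def s_def)
  qed
qed

section \<open>Distance to the nearest kth power\<close>

lemma power_Suc_diff_le:
  fixes m :: nat
  shows "(m + 1) ^ Suc j \<le> m ^ Suc j + Suc j * (m + 1) ^ j"
proof (induction j)
  case (Suc j)
  have "(m + 1) ^ Suc (Suc j) \<le> (m + 1) * (m ^ Suc j + Suc j * (m + 1) ^ j)"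
    using mult_left_mono[OF Suc, of "m + 1"] by simp
  also have "\<dots> = m ^ Suc (Suc j) + m ^ Suc j + Suc j * (m + 1) ^ Suc j"
    by (simp add: algebra_simps)
  also have "\<dots> \<le> m ^ Suc (Suc j) + (m + 1) ^ Suc j + Suc j * (m + 1) ^ Suc j"
    by (intro add_mono power_mono) auto
  finally show ?case by simp
qed simp

text \<open>Take \<open>m\<close> to be the integer part of the kth root of \<open>p\<close>. The
  distance from \<open>p\<close> down to \<open>m ^ k\<close> is less than the gap between
  consecutive kth powers, and \<open>m + 1 \<le> 2 * m\<close> turns the bound on that gap into a
  multiple of \<open>m ^ (k - 1)\<close>.\<close>

lemma near_perfect_power:
  fixes k p :: nat
  assumes "k \<ge> 1" "p \<ge> 1"
  obtains m where "m \<ge> 1" "m ^ k \<le> p" "p - m ^ k \<le> k * 2 ^ (k - 1) * m ^ (k - 1)"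
proof -
  obtain j where k: "k = Suc j" using assms by (cases k) auto
  define m where "m = (LEAST m. p < (m + 1) ^ k)"
  have "p < (p + 1) ^ k" using self_le_power[of "p + 1" k] k by linarith
  then have up: "p < (m + 1) ^ k" unfolding m_def by (rule LeastI)
  have m: "m \<ge> 1" using up assms by (cases m) auto
  have low: "m ^ k \<le> p"
  proof (rule ccontr)
    assume "\<not> m ^ k \<le> p"
    then have "p < (m - 1 + 1) ^ k" using m by simp
    then have "m \<le> m - 1" unfolding m_def by (rule Least_le)
    with m show False by simp
  qed
  have "p - m ^ k \<le> Suc j * (m + 1) ^ j"
    using up power_Suc_diff_le[of m j] unfolding k by linarith
  also have "\<dots> \<le> Suc j * (2 * m) ^ j"
    using m by (intro mult_left_mono power_mono) auto
  finally have "p - m ^ k \<le> k * 2 ^ (k - 1) * m ^ (k - 1)"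
    using k by (simp add: power_mult_distrib algebra_simps)
  with m low show ?thesis by (rule that)
qed

lemma partition_number_pos: "partition_number n \<ge> 1"
proof (cases "n = 0")
  case False
  then have "{#n#} \<in> partitions n" by (simp add: partitions_def)
  then have "partition_number n \<noteq> 0"
    using finite_partitions by (auto simp: partition_number_def)
  then show ?thesis by simp
qed (simp add: partition_number_zero)

text \<open>The distance is at most a constant times \<open>m ^ (k - 1)\<close>, where
  \<open>m\<close> is at most the kth root of p(n); so the exponent in the bound for p(n) gets
  multiplied by \<open>(k - 1) / k\<close>.\<close>

lemma power_dist_upper_bound:
  assumes "k \<ge> 1"
  shows "real (power_dist k n)
    \<le> real (k * 2 ^ (k - 1)) * exp ((real k - 1) / real k * (pi * sqrt (2 / 3) * sqrt (real n)))"
proof -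
  let ?p = "partition_number n" and ?c = "pi * sqrt (2 / 3) * sqrt (real n)"
  obtain m where m: "m \<ge> 1" "m ^ k \<le> ?p" "?p - m ^ k \<le> k * 2 ^ (k - 1) * m ^ (k - 1)"
    using near_perfect_power[OF assms partition_number_pos] by blast
  have "int (power_dist k n) \<le> \<bar>int ?p - int m ^ k\<bar>" by (rule power_dist_le)
  also have "\<dots> = int (?p - m ^ k)" using m(2) by (simp add: of_nat_diff of_nat_power[symmetric] del: of_nat_power)
  finally have "power_dist k n \<le> k * 2 ^ (k - 1) * m ^ (k - 1)" using m(3) by linarith
  then have "real (power_dist k n) \<le> real (k * 2 ^ (k - 1)) * real m ^ (k - 1)"
    by (metis of_nat_le_iff of_nat_mult of_nat_power)
  also have "real m ^ (k - 1) \<le> exp ((real k - 1) / real k * ?c)"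
  proof -
    have "real m ^ k \<le> real ?p" using m(2) by (metis of_nat_le_iff of_nat_power)
    also have "\<dots> \<le> exp ?c" by (rule partition_number_upper_bound)
    finally have "ln (real m ^ k) \<le> ln (exp ?c)" using m(1) by (subst ln_le_cancel_iff) auto
    then have "real k * ln (real m) \<le> ?c" using m(1) by (simp add: ln_realpow mult.assoc)
    then have "ln (real m) \<le> ?c / real k" using assms by (simp add: field_simps)
    then have "(real k - 1) * ln (real m) \<le> (real k - 1) * (?c / real k)"
      using assms by (intro mult_left_mono) auto
    then have "exp (real (k - 1) * ln (real m)) \<le> exp ((real k - 1) / real k * ?c)"
      using assms by (simp add: of_nat_diff)
    then show ?thesis using m(1) by (simp add: exp_of_nat_mult)
  qed
  finally show ?thesis by (simp add: mult_left_mono)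
qed

section \<open>Choosing \<open>n\<close> in terms of \<open>d\<close>\<close>

lemma max_power_index_ge:
  assumes "n \<ge> 1" "power_dist k n \<le> d"
  shows "enat n \<le> max_power_index k d"
  using assms by (auto simp: max_power_index_def Let_def)

theorem theorem1p1:
  fixes k :: nat
  assumes "k \<ge> 2"
  shows "\<exists>C>0. \<exists>d0::nat. \<forall>d\<ge>d0.
    ereal_of_enat (max_power_index k d) \<ge>
      ereal (3 / (2 * pi\<^sup>2) * (real k / (real k - 1))\<^sup>2 * (ln (real d))\<^sup>2
             - C * ln (real d) * ln (ln (real d)))"
proof -
  define c where "c = pi * sqrt (2 / 3)"
  define r where "r = real k / (real k - 1)"
  define K where "K = real (k * 2 ^ (k - 1))"
  \<comment> \<open>Equal to \<open>r\<^sup>2 / c\<^sup>2\<close>, the leading coefficient of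
    \<open>x\<^sup>2\<close> below.\<close>
  define A where "A = 3 / (2 * pi\<^sup>2) * r\<^sup>2"
  \<comment> \<open>The first summand is the linear coefficient from expanding
    \<open>A * (L - ln K)\<^sup>2\<close>; the 1 pays for rounding \<open>x\<^sup>2\<close>
    down.\<close>
  define C where "C = 2 * A * ln K + 1"
  \<comment> \<open>Large enough that \<open>ln d \<ge> L0\<close> gives both
    \<open>x \<ge> 1\<close> and \<open>ln (ln d) \<ge> 1\<close>.\<close>
  define L0 where "L0 = ln K + c + exp 1"
  have c: "c > 0" "c\<^sup>2 = pi\<^sup>2 * (2 / 3)" by (auto simp: c_def power_mult_distrib)
  have r: "r \<ge> 1" using assms by (simp add: r_def field_simps)
  have K: "K \<ge> 1"
  proof -
    have "k * 2 ^ (k - 1) \<ge> 1" using assms by (simp add: Suc_le_eq)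
    then show ?thesis unfolding K_def by linarith
  qed
  have A: "A > 0" using r by (simp add: A_def)
  have C: "C > 0" using A K by (simp add: C_def add_nonneg_pos)
  have main: "ereal (A * (ln (real d))\<^sup>2 - C * ln (real d) * ln (ln (real d)))
      \<le> ereal_of_enat (max_power_index k d)" if d: "d \<ge> nat \<lceil>exp L0\<rceil>" for d
  proof -
    define L where "L = ln (real d)"
    have dexp: "exp L0 \<le> real d" using d by linarith
    then have d0: "real d > 0" using exp_gt_zero[of L0] by linarith
    have L: "L \<ge> L0" using dexp d0 by (simp add: L_def ln_ge_iff)
    have lnK: "ln K \<ge> 0" using K by simp
    have Lc: "L - ln K \<ge> c" and Le: "L \<ge> exp 1"
      using L c lnK exp_gt_zero[of 1] unfolding L0_def by linarith+
    have L1: "L \<ge> 1" using Le exp_ge_add_one_self[of 1] by linarith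
    have lnL: "ln L \<ge> 1" using Le L1 by (simp add: ln_ge_iff)
    \<comment> \<open>The value of \<open>sqrt n\<close> at which the bound of
      \<open>power_dist_upper_bound\<close> equals \<open>d\<close>.\<close>
    define x where "x = (L - ln K) * r / c"
    have x: "x \<ge> 1"
    proof -
      have "c * 1 \<le> (L - ln K) * r" using Lc r c by (intro mult_mono) auto
      then show ?thesis using c by (simp add: x_def)
    qed
    define n where "n = nat \<lfloor>x\<^sup>2\<rfloor>"
    have x2: "x\<^sup>2 \<ge> 1" using x by (simp add: one_le_power)
    have n: "n \<ge> 1" "real n \<le> x\<^sup>2" "real n \<ge> x\<^sup>2 - 1" using x2 unfolding n_def by linarith+
    have "sqrt (real n) \<le> x" using n(2) x by (intro real_le_lsqrt) auto
    then have "(real k - 1) / real k * (c * sqrt (real n)) \<le> (real k - 1) / real k * (c * x)"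
      using c assms by (intro mult_left_mono) auto
    also have "\<dots> = L - ln K" using c assms by (simp add: x_def r_def)
    finally have "exp ((real k - 1) / real k * (c * sqrt (real n))) \<le> exp (L - ln K)" by simp
    also have "\<dots> = real d / K" using K d0 by (simp add: exp_diff L_def)
    finally have "K * exp ((real k - 1) / real k * (c * sqrt (real n))) \<le> real d"
      using K by (simp add: field_simps)
    moreover have "real (power_dist k n) \<le> K * exp ((real k - 1) / real k * (c * sqrt (real n)))"
      unfolding K_def c_def using assms by (intro power_dist_upper_bound) simp
    ultimately have "power_dist k n \<le> d" by linarith
    with n(1) have le: "enat n \<le> max_power_index k d" by (rule max_power_index_ge)
    have "x\<^sup>2 = A * (L - ln K)\<^sup>2"
      by (simp add: x_def A_def power_divide power_mult_distrib c mult_ac)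
    also have "\<dots> = A * L\<^sup>2 - 2 * A * ln K * L + A * (ln K)\<^sup>2"
      by (simp add: power2_diff algebra_simps)
    finally have "x\<^sup>2 \<ge> A * L\<^sup>2 - 2 * A * ln K * L" using A by simp
    \<comment> \<open>The error found is linear in \<open>L\<close>; as \<open>ln L \<ge> 1\<close>,
      it is at most \<open>C * L * ln L\<close>.\<close>
    moreover have "C * L * 1 \<le> C * L * ln L" using C L1 lnL by (intro mult_left_mono) auto
    moreover have "C * L = 2 * A * ln K * L + L" by (simp add: C_def algebra_simps)
    ultimately have "A * L\<^sup>2 - C * L * ln L \<le> real n" using n(3) L1 by linarith
    then have "ereal (A * L\<^sup>2 - C * L * ln L) \<le> ereal_of_enat (enat n)" by simp
    also have "\<dots> \<le> ereal_of_enat (max_power_index k d)" using le by (simp only: ereal_of_enat_le_iff)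
    finally show ?thesis by (simp add: L_def)
  qed
  show ?thesis
    using C main unfolding A_def r_def by blast
qed

end
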